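(* Let $c\geq 0$ and $b\geq 2$ be integers. Let $a\in\mathbb{Z}^+$ have exactly $n+1>3$ digits in base $b$ and satisfy $S_{[c,b]}(a)=a$. Let $\hat c\geq 0$ be an integer such that $c$ and $\hat c$ lie in a common oasis base $b$ (i.e., for every integer $t$ between $c$ and $\hat c$ inclusive, $S_{[t,b]}$ has a fixed point). Then every fixed point of $S_{[\hat c,b]}$ has exactly $n+1$ digits in base $b$.
   Context: For integers $c\geq 0$ and $b\geq 2$, the augmented generalized happy function $S_{[c,b]}:\mathbb{Z}^+\to\mathbb{Z}^+$ is defined by $S_{[c,b]}\left(\sum_{i=0}^n a_i b^i\right)=c+\sum_{i=0}^n a_i^2$, where $0\le a_i\le b-1$, $a_n\neq 0$ (the base $b$ expansion; such a number has $n+1$ digits). A positive integer $a$ is a fixed point of $S_{[c,b]}$ if $S_{[c,b]}(a)=a$. An oasis base $b$ is a set of consecutive non-negative integers $c$ such that for each of them $S_{[c,b]}$ has at least one fixed point. *)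

theory Defs
  imports Main
begin

definition digit :: "nat \<Rightarrow> nat \<Rightarrow> nat \<Rightarrow> nat" where
  "digit b a i = a div b ^ i mod b"

(* For b >= 2 this is the n + 1 of the base b expansion a = (SUM i<=n. a_i * b^i) with a_n ~= 0,
   see base_expansion below. *)
definition num_digits :: "nat \<Rightarrow> nat \<Rightarrow> nat" where
  "num_digits b a = (LEAST k. a < b ^ k)"

definition aug_happy :: "nat \<Rightarrow> nat \<Rightarrow> nat \<Rightarrow> nat" where
  "aug_happy c b a = c + (\<Sum>i<num_digits b a. (digit b a i)\<^sup>2)"

(* The domain of the augmented happy function consists of the positive integers only,
   so 0 never counts as a fixed point (although aug_happy 0 b 0 = 0). *)
definition is_fixed_point :: "nat \<Rightarrow> nat \<Rightarrow> nat \<Rightarrow> bool" where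
  "is_fixed_point c b a \<longleftrightarrow> 0 < a \<and> aug_happy c b a = a"

definition is_oasis :: "nat \<Rightarrow> nat set \<Rightarrow> bool" where
  "is_oasis b C \<longleftrightarrow>
     (\<forall>x\<in>C. \<forall>y\<in>C. {x..y} \<subseteq> C) \<and> (\<forall>c\<in>C. \<exists>a. is_fixed_point c b a)"

lemma expansion_less:
  fixes b :: nat
  assumes "\<forall>i<k. f i < b"
  shows "(\<Sum>i<k. f i * b ^ i) < b ^ k"
  using assms
proof (induction k)
  case (Suc k)
  then have "(\<Sum>i<Suc k. f i * b ^ i) < b ^ k + f k * b ^ k" by simp
  also have "\<dots> = Suc (f k) * b ^ k" by simp
  also have "\<dots> \<le> b * b ^ k" using Suc.prems by (intro mult_right_mono) (auto simp: Suc_leI)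
  finally show ?case by simp
qed simp

lemma base_expansion:
  fixes b n :: nat and f :: "nat \<Rightarrow> nat"
  assumes b: "2 \<le> b" and f: "\<forall>i\<le>n. f i < b" and top: "f n \<noteq> 0"
    and a: "a = (\<Sum>i\<le>n. f i * b ^ i)"
  shows "num_digits b a = n + 1"
    and "i \<le> n \<Longrightarrow> digit b a i = f i"
    and "aug_happy c b a = c + (\<Sum>i\<le>n. (f i)\<^sup>2)"
proof -
  have a': "a = (\<Sum>i<Suc n. f i * b ^ i)" using a by (simp add: lessThan_Suc_atMost)
  have upper: "a < b ^ Suc n" unfolding a' by (rule expansion_less) (use f in auto)
  have "1 * b ^ n \<le> f n * b ^ n" using top by (intro mult_right_mono) auto
  also have "\<dots> \<le> a" unfolding a' by simp
  finally have lower: "b ^ n \<le> a" by simp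
  show nd: "num_digits b a = n + 1"
    unfolding num_digits_def
  proof (rule Least_equality)
    show "a < b ^ (n + 1)" using upper by simp
    fix k assume "a < b ^ k"
    then have "b ^ n < b ^ k" using lower by simp
    then have "n < k" using b by simp
    then show "n + 1 \<le> k" by simp
  qed
  have dg: "digit b a i = f i" if i: "i \<le> n" for i
  proof -
    have split: "\<exists>q. (\<Sum>j<i + Suc d. f j * b ^ j) = (\<Sum>j<i. f j * b ^ j) + b ^ i * (f i + b * q)" for d
    proof (induction d)
      case 0
      show ?case by (intro exI[of _ 0]) simp
    next
      case (Suc d)
      then obtain q where
        "(\<Sum>j<i + Suc d. f j * b ^ j) = (\<Sum>j<i. f j * b ^ j) + b ^ i * (f i + b * q)" by blast
      then show ?case
        by (intro exI[of _ "q + f (i + Suc d) * b ^ d"])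
           (simp add: algebra_simps power_add)
    qed
    obtain q where q: "a = (\<Sum>j<i. f j * b ^ j) + b ^ i * (f i + b * q)"
      using split[of "n - i"] i a' by auto
    have "(\<Sum>j<i. f j * b ^ j) < b ^ i" by (rule expansion_less) (use f i in auto)
    then have "a div b ^ i = f i + b * q" using q b by simp
    then show ?thesis using f i by (simp add: digit_def)
  qed
  then show "i \<le> n \<Longrightarrow> digit b a i = f i" .
  show "aug_happy c b a = c + (\<Sum>i\<le>n. (f i)\<^sup>2)"
    unfolding aug_happy_def nd by (simp add: lessThan_Suc_atMost dg)
qed

end

theory Submission
  imports Defs
begin

text \<open>A fixed point $a$ with digits $a_i$ satisfies $c = \sum_i a_i (b^i - a_i)$. The summand is at
  least $-(b-1)(b-2)$ for $i = 0$, at most $b^2/4$ for $i = 1$, and increasing in $a_i$ for $i \ge 2$.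
  Hence for $k \ge 3$ the fixed points below $b^k$ only produce values
  $c \le b^k - b^2 - (b-1)^2 + b^2/4$, while those from $b^k$ on only produce values
  $c \ge b^k - 1 - (b-1)(b-2)$. These two bounds are at least $2$ apart, so the value just below the
  second one has no fixed point, and no oasis contains values from both sides of it.\<close>

lemma mod_power_eq_sum_digits: "a mod b ^ k = (\<Sum>i<k. digit b a i * b ^ i)"
proof (induction k)
  case (Suc k)
  have "a mod (b ^ k * b) = b ^ k * (a div b ^ k mod b) + a mod b ^ k"
    by (rule mod_mult2_eq)
  then show ?case
    using Suc by (simp add: digit_def mult.commute)
qed simp

lemma less_power_num_digits:
  assumes "2 \<le> b"
  shows "a < b ^ num_digits b a"
proof -
  have "a < b ^ a"
    using assms by (simp add: power_gt_expt)
  then show ?thesis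
    unfolding num_digits_def by (rule LeastI)
qed

lemma num_digits_le: "a < b ^ k \<Longrightarrow> num_digits b a \<le> k"
  unfolding num_digits_def by (rule Least_le)

lemma power_le_if_less_num_digits: "k < num_digits b a \<Longrightarrow> b ^ k \<le> a"
  using num_digits_le[of a b k] by linarith

text \<open>Digits beyond \<open>num_digits b a\<close> are zero, so the sum of squares may run up
  to any \<open>k\<close> with \<open>a < b ^ k\<close>. This aligns it with the expansion of
  \<open>a\<close> over the same range.\<close>

lemma aug_happy_eq_sum:
  assumes b: "2 \<le> b" and a: "a < b ^ k"
  shows "aug_happy c b a = c + (\<Sum>i<k. (digit b a i)\<^sup>2)"
proof -
  have "digit b a i = 0" if "num_digits b a \<le> i" for i
  proof -
    have "b ^ num_digits b a \<le> b ^ i"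
      using that b by (intro power_increasing) auto
    then have "a < b ^ i"
      using less_power_num_digits[OF b, of a] by linarith
    then show ?thesis
      by (simp add: digit_def)
  qed
  then have "(\<Sum>i<num_digits b a. (digit b a i)\<^sup>2) = (\<Sum>i<k. (digit b a i)\<^sup>2)"
    using num_digits_le[OF a] by (intro sum.mono_neutral_left) auto
  then show ?thesis
    by (simp add: aug_happy_def)
qed

text \<open>Subtracting the squared digits from the expansion of \<open>a\<close> leaves
  \<open>c\<close>. The sum lives in \<open>int\<close> because its term for \<open>i = 0\<close> is
  \<open>d * (1 - d)\<close>, negative once the units digit exceeds 1.\<close>

lemma fixed_point_constant_eq:
  assumes b: "2 \<le> b" and a: "a < b ^ k" and fp: "is_fixed_point c b a"
  shows "int c = (\<Sum>i<k. int (digit b a i) * (int b ^ i - int (digit b a i)))"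
proof -
  have "a = c + (\<Sum>i<k. (digit b a i)\<^sup>2)"
    using fp aug_happy_eq_sum[OF b a, of c] by (simp add: is_fixed_point_def)
  then have "int a = int c + (\<Sum>i<k. (int (digit b a i))\<^sup>2)"
    by (metis (mono_tags, lifting) of_nat_add of_nat_power of_nat_sum sum.cong)
  moreover have "a = (\<Sum>i<k. digit b a i * b ^ i)"
    using mod_power_eq_sum_digits[of a b k] a by simp
  then have "int a = (\<Sum>i<k. int (digit b a i) * int b ^ i)"
    by (metis (mono_tags, lifting) of_nat_mult of_nat_power of_nat_sum sum.cong)
  ultimately show ?thesis
    by (simp add: right_diff_distrib sum_subtractf power2_eq_square)
qed

lemma digit_bounds:
  assumes "2 \<le> b"
  shows "0 \<le> int (digit b a i)" "int (digit b a i) \<le> int b - 1"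
proof -
  have "digit b a i < b"
    using assms by (simp add: digit_def)
  then show "int (digit b a i) \<le> int b - 1"
    by linarith
qed simp

text \<open>The case \<open>k = 3\<close> bounds its three terms separately. Each further position
  \<open>m\<close> adds at most \<open>B ^ Suc m - B ^ m\<close>, so the bound telescopes. The
  factor 4 clears the denominator of the maximum \<open>B\<^sup>2 / 4\<close> at position 1.\<close>

lemma fixed_point_constant_upper:
  assumes b: "2 \<le> b" and k: "3 \<le> k" and a: "a < b ^ k" and fp: "is_fixed_point c b a"
  shows "4 * int c \<le> 4 * int b ^ k - 3 * (int b)\<^sup>2 - 4 * (int b - 1)\<^sup>2"
proof -
  define B where "B = int b"
  define d where "d i = int (digit b a i)" for i
  have B: "2 \<le> B"
    using b by (simp add: B_def)
  have d: "0 \<le> d i" "d i \<le> B - 1" for i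
    using digit_bounds[OF b] by (auto simp: B_def d_def)
  have "4 * (\<Sum>i<k. d i * (B ^ i - d i)) \<le> 4 * B ^ k - 3 * B\<^sup>2 - 4 * (B - 1)\<^sup>2"
    using k
  proof (induction k rule: dec_induct)
    case base
    have "d 0 * (1 - d 0) \<le> 0"
      using d[of 0] by (cases "d 0 = 0") (auto intro: mult_nonneg_nonpos)
    moreover have "4 * (d 1 * (B - d 1)) \<le> B\<^sup>2"
      using zero_le_power2[of "B - 2 * d 1"] by (simp add: power2_eq_square algebra_simps)
    moreover have "d 2 * (B\<^sup>2 - d 2) \<le> (B - 1) * (B\<^sup>2 - (B - 1))"
    proof -
      have "2 * B \<le> B\<^sup>2"
        using B by (simp add: power2_eq_square)
      \<comment> \<open>This product is the right side minus the left side of the claim.\<close>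
      then have "0 \<le> (B - 1 - d 2) * (B\<^sup>2 - (B - 1) - d 2)"
        using d[of 2] B by (intro mult_nonneg_nonneg) auto
      then show ?thesis
        by (simp add: algebra_simps)
    qed
    moreover have "(\<Sum>i<3. d i * (B ^ i - d i))
        = d 0 * (1 - d 0) + d 1 * (B - d 1) + d 2 * (B\<^sup>2 - d 2)"
      by (simp add: numeral_3_eq_3 numeral_2_eq_2)
    moreover have "(B - 1) * (B\<^sup>2 - (B - 1)) = B ^ 3 - B\<^sup>2 - (B - 1)\<^sup>2"
      by (simp add: power2_eq_square power3_eq_cube algebra_simps)
    ultimately show ?case
      by linarith
  next
    case (step m)
    have "d m * (B ^ m - d m) \<le> d m * B ^ m"
      using d[of m] by (intro mult_left_mono) auto
    also have "\<dots> \<le> (B - 1) * B ^ m"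
      using d[of m] B by (intro mult_right_mono) auto
    finally have "d m * (B ^ m - d m) \<le> B ^ Suc m - B ^ m"
      by (simp add: algebra_simps)
    then show ?case
      using step.IH by simp
  qed
  then show ?thesis
    using fixed_point_constant_eq[OF b a fp] by (simp add: B_def d_def)
qed

text \<open>Only the units digit can contribute negatively. The nonzero leading digit, at some
  position \<open>n\<close> with \<open>k \<le> n\<close>, contributes least when it is 1.\<close>

lemma fixed_point_constant_lower:
  assumes b: "2 \<le> b" and k: "1 \<le> k" and a: "b ^ k \<le> a" and fp: "is_fixed_point c b a"
  shows "int b ^ k - 1 - (int b - 1) * (int b - 2) \<le> int c"
proof -
  define B where "B = int b"
  define d where "d i = int (digit b a i)" for i
  define n where "n = num_digits b a - 1"
  have B: "2 \<le> B"
    using b by (simp add: B_def)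
  have d: "0 \<le> d i" "d i \<le> B - 1" for i
    using digit_bounds[OF b] by (auto simp: B_def d_def)
  have "b ^ k < b ^ num_digits b a"
    using a less_power_num_digits[OF b, of a] by linarith
  then have nd: "k < num_digits b a"
    using b by simp
  then have kn: "k \<le> n" and upper: "a < b ^ Suc n" and lower: "b ^ n \<le> a"
    using less_power_num_digits[OF b, of a] power_le_if_less_num_digits[of n b a]
    by (auto simp: n_def)
  have pw: "B \<le> B ^ i" if "1 \<le> i" for i
    using power_increasing[OF that, of B] B by simp
  have "1 \<le> a div b ^ n"
    using lower b by (simp add: Suc_le_eq div_greater_zero_iff)
  moreover have "a div b ^ n < b"
    using upper by (simp add: less_mult_imp_div_less)
  ultimately have "1 \<le> d n"
    by (simp add: d_def digit_def)
  \<comment> \<open>The product is \<open>d n * (B ^ n - d n)\<close> minus its value for leading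
    digit 1.\<close>
  then have "0 \<le> (d n - 1) * (B ^ n - 1 - d n)"
    using d[of n] pw[of n] k kn by (intro mult_nonneg_nonneg) auto
  then have top: "B ^ n - 1 \<le> d n * (B ^ n - d n)"
    by (simp add: algebra_simps)
  \<comment> \<open>Likewise, \<open>d * (1 - d)\<close> is least at the largest digit
    \<open>B - 1\<close>; the product is the excess over that minimum.\<close>
  have "0 \<le> (B - 1 - d 0) * (B - 2 + d 0)"
    using d[of 0] B by (intro mult_nonneg_nonneg) auto
  then have zero: "- ((B - 1) * (B - 2)) \<le> d 0 * (1 - d 0)"
    by (simp add: algebra_simps)
  have mid: "0 \<le> (\<Sum>i\<in>{1..<n}. d i * (B ^ i - d i))"
  proof (intro sum_nonneg mult_nonneg_nonneg)
    fix i assume "i \<in> {1..<n}"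
    then show "0 \<le> d i" "0 \<le> B ^ i - d i"
      using d[of i] pw[of i] by auto
  qed
  have "{..<n} = insert 0 {1..<n}"
    using k kn by auto
  then have "(\<Sum>i<Suc n. d i * (B ^ i - d i))
      = d 0 * (1 - d 0) + (\<Sum>i\<in>{1..<n}. d i * (B ^ i - d i)) + d n * (B ^ n - d n)"
    by simp
  moreover have "B ^ k \<le> B ^ n"
    using kn B by (intro power_increasing) auto
  ultimately have "B ^ k - 1 - (B - 1) * (B - 2) \<le> (\<Sum>i<Suc n. d i * (B ^ i - d i))"
    using top zero mid by linarith
  then show ?thesis
    using fixed_point_constant_eq[OF b upper fp] by (simp only: B_def d_def)
qed

lemma oasis_separated:
  assumes b: "2 \<le> b" and k: "3 \<le> k"
    and C: "is_oasis b C" "c \<in> C" "c' \<in> C"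
    and a: "is_fixed_point c b a" "a < b ^ k"
    and a': "is_fixed_point c' b a'" "b ^ k \<le> a'"
  shows False
proof -
  \<comment> \<open>One less than the bound of \<open>fixed_point_constant_lower\<close>, hence
    missed by every fixed point from \<open>b ^ k\<close> on.\<close>
  define L where "L = int b ^ k - 2 - (int b - 1) * (int b - 2)"
  have lo: "L < int t" if "is_fixed_point t b x" "b ^ k \<le> x" for t x
    using fixed_point_constant_lower[OF b _ that(2,1)] k by (simp add: L_def)
  have hi: "int t < L" if "is_fixed_point t b x" "x < b ^ k" for t x
  proof -
    have "4 * int t \<le> 4 * int b ^ k - 3 * (int b)\<^sup>2 - 4 * (int b - 1)\<^sup>2"
      by (rule fixed_point_constant_upper[OF b k that(2,1)])
    then have "4 * int t \<le> 4 * int b ^ k + 8 * int b - 4 - 7 * (int b * int b)"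
      by (simp add: power2_eq_square algebra_simps)
    moreover have "L = int b ^ k + 3 * int b - 4 - int b * int b"
      by (simp add: L_def algebra_simps)
    \<comment> \<open>With \<open>b\<close> for \<open>int b\<close>, \<open>4 * L\<close> exceeds
      the upper bound by \<open>3 * b * b + 4 * b - 12\<close>, which is positive for
      \<open>2 \<le> b\<close>.\<close>
    moreover have "2 * int b \<le> int b * int b"
      using b by simp
    ultimately show ?thesis
      using b by linarith
  qed
  have "int c < L" "L < int c'"
    using hi[OF a] lo[OF a'] by auto
  \<comment> \<open>Lying above \<open>c\<close>, \<open>L\<close> is a natural number; being
    between \<open>c\<close> and \<open>c'\<close>, it belongs to the oasis.\<close>
  then obtain t where t: "int t = L" "t \<in> {c..c'}"
    by (metis atLeastAtMost_iff less_imp_le nonneg_int_cases of_nat_0_le_iff of_nat_le_iff order_trans)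
  then have "t \<in> C"
    using C unfolding is_oasis_def by blast
  then obtain x where "is_fixed_point t b x"
    using C unfolding is_oasis_def by blast
  then show False
    using hi[of t x] lo[of t x] t by linarith
qed

theorem theorem5:
  fixes b c c' n a :: nat and C :: "nat set"
  assumes "2 \<le> b"
    and "0 < a" and "num_digits b a = n + 1" and "n + 1 > 3"
    and "is_fixed_point c b a"
    and "is_oasis b C" and "c \<in> C" and "c' \<in> C"
  shows "\<forall>a'. is_fixed_point c' b a' \<longrightarrow> num_digits b a' = n + 1"
proof (intro allI impI)
  fix a' assume fp': "is_fixed_point c' b a'"
  note b = \<open>2 \<le> b\<close>
  have an: "b ^ n \<le> a" "a < b ^ Suc n"
    using power_le_if_less_num_digits[of n b a] less_power_num_digits[OF b, of a] assms(3) by auto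
  \<comment> \<open>Separation at \<open>b ^ n\<close>, with \<open>a'\<close> as the smaller fixed
    point; \<open>n + 1 > 3\<close> gives the required \<open>3 \<le> n\<close>. The upper bound on
    \<open>a'\<close> below uses separation at \<open>b ^ Suc n\<close> with the roles
    exchanged.\<close>
  have "b ^ n \<le> a'"
    using oasis_separated[OF b _ assms(6,8,7) fp' _ assms(5) an(1)] assms(4) by fastforce
  then have "b ^ n < b ^ num_digits b a'"
    using less_power_num_digits[OF b, of a'] by linarith
  then have "n < num_digits b a'"
    using b by simp
  moreover have "a' < b ^ Suc n"
    using oasis_separated[OF b _ assms(6-8,5) an(2) fp'] assms(4) by fastforce
  then have "num_digits b a' \<le> Suc n"
    by (rule num_digits_le)
  ultimately show "num_digits b a' = n + 1"
    by linarith
qed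

end
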